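(* For every integer $n \ge 1$ there exists a polynomial $P(X_1,\ldots,X_n) \in \mathbb{R}[X_1,\ldots,X_n]$ that sign represents the parity function over $\{1,2\}^n$, has total degree $n^2$ and has sparsity $n+1$.
   Context: For $A \subseteq \mathbb{Z}$, the parity function $\mathrm{Par}: A^n \to \{0,1\}$ is $\mathrm{Par}(a_1,\ldots,a_n) = \sum_{i=1}^n a_i \bmod 2$. A polynomial $P$ sign represents $f: A^n \to \{0,1\}$ if for every $a \in A^n$: $f(a) = 0 \Rightarrow P(a) > 0$ and $f(a) = 1 \Rightarrow P(a) < 0$. The sparsity of $P$ is the number of monomials with nonzero coefficient in the standard monomial basis. *)

theory Defs
  imports Complex_Main "HOL-Library.Poly_Mapping" "HOL-Library.FuncSet"
begin

text \<open>
  A monomial is a finitely supported map from variable indices to exponents; a real polynomial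
  is a finitely supported map from monomials to coefficients, so \<^const>\<open>Poly_Mapping.keys\<close> is
  the set of monomials with nonzero coefficient.
\<close>

type_synonym monomial = "nat \<Rightarrow>\<^sub>0 nat"
type_synonym real_mpoly = "monomial \<Rightarrow>\<^sub>0 real"

definition mpoly_vars :: "real_mpoly \<Rightarrow> nat set" where
  "mpoly_vars P = (\<Union>m\<in>Poly_Mapping.keys P. Poly_Mapping.keys m)"

text \<open>The polynomial ring over the reals in the variables $X_1, \ldots, X_n$.\<close>

definition mpolys_in :: "nat \<Rightarrow> real_mpoly set" where
  "mpolys_in n = {P. mpoly_vars P \<subseteq> {1..n}}"

definition monomial_eval :: "(nat \<Rightarrow> real) \<Rightarrow> monomial \<Rightarrow> real" where
  "monomial_eval x m = (\<Prod>i\<in>Poly_Mapping.keys m. x i ^ Poly_Mapping.lookup m i)"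

definition mpoly_eval :: "real_mpoly \<Rightarrow> (nat \<Rightarrow> real) \<Rightarrow> real" where
  "mpoly_eval P x =
     (\<Sum>m\<in>Poly_Mapping.keys P. Poly_Mapping.lookup P m * monomial_eval x m)"

definition monomial_degree :: "monomial \<Rightarrow> nat" where
  "monomial_degree m = (\<Sum>i\<in>Poly_Mapping.keys m. Poly_Mapping.lookup m i)"

text \<open>The zero polynomial gets degree 0.\<close>

definition total_degree :: "real_mpoly \<Rightarrow> nat" where
  "total_degree P = Max (insert 0 (monomial_degree ` Poly_Mapping.keys P))"

definition sparsity :: "real_mpoly \<Rightarrow> nat" where
  "sparsity P = card (Poly_Mapping.keys P)"

text \<open>Points of $A^n$ are extensional functions on \<^term>\<open>{1..n}\<close>.\<close>

definition cube :: "int set \<Rightarrow> nat \<Rightarrow> (nat \<Rightarrow> int) set" where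
  "cube A n = ({1..n} \<rightarrow>\<^sub>E A)"

definition parity_fun :: "nat \<Rightarrow> (nat \<Rightarrow> int) \<Rightarrow> int" where
  "parity_fun n a = (\<Sum>i=1..n. a i) mod 2"

definition sign_represents ::
  "real_mpoly \<Rightarrow> int set \<Rightarrow> nat \<Rightarrow> ((nat \<Rightarrow> int) \<Rightarrow> int) \<Rightarrow> bool" where
  "sign_represents P A n f \<longleftrightarrow>
     (\<forall>a\<in>cube A n.
        (f a = 0 \<longrightarrow> mpoly_eval P (\<lambda>i. real_of_int (a i)) > 0) \<and>
        (f a = 1 \<longrightarrow> mpoly_eval P (\<lambda>i. real_of_int (a i)) < 0))"

end

theory Submission
  imports Defs "HOL-Computational_Algebra.Polynomial"
begin

text \<open>
  On \<open>{1,2}\<^sup>n\<close> the product \<open>X\<^sub>1 \<cdots> X\<^sub>n\<close> equals \<open>2\<^sup>k\<close>, where \<open>k\<close> is the number of twos, and the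
  parity is that of \<open>n - k\<close>. So it suffices to substitute \<open>X\<^sub>1 \<cdots> X\<^sub>n\<close> into a univariate
  polynomial of degree \<open>n\<close> whose roots separate \<open>1, 2, 4, \<dots>, 2\<^sup>n\<close>. All its roots being positive,
  its coefficients strictly alternate in sign, so none of the \<open>n + 1\<close> of them vanishes.
\<close>

definition diag_monomial :: "nat \<Rightarrow> nat \<Rightarrow> monomial" where
  "diag_monomial n j = (\<Sum>i=1..n. Poly_Mapping.single i j)"

text \<open>The substitution \<open>q(X_1 ... X_n)\<close>, spelled out by coefficients so that its
  support can be read off from that of \<open>q\<close>.\<close>

definition diag_mpoly :: "nat \<Rightarrow> real poly \<Rightarrow> real_mpoly" where
  "diag_mpoly n q = (\<Sum>j\<le>degree q. Poly_Mapping.single (diag_monomial n j) (coeff q j))"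

lemma lookup_diag_monomial:
  "Poly_Mapping.lookup (diag_monomial n j) i = (if i \<in> {1..n} then j else 0)"
  by (simp add: diag_monomial_def lookup_sum lookup_single when_def)

lemma keys_diag_monomial:
  "Poly_Mapping.keys (diag_monomial n j) = (if j = 0 then {} else {1..n})"
  by (auto simp: in_keys_iff lookup_diag_monomial simp del: keys_eq_empty split: if_splits)

lemma monomial_eval_diag_monomial:
  "monomial_eval x (diag_monomial n j) = (\<Prod>i=1..n. x i) ^ j"
  by (auto simp: monomial_eval_def keys_diag_monomial lookup_diag_monomial prod_power_distrib)

lemma monomial_degree_diag_monomial: "monomial_degree (diag_monomial n j) = n * j"
  by (simp add: monomial_degree_def keys_diag_monomial lookup_diag_monomial)

text \<open>The exponent of \<open>X_1\<close> recovers \<open>j\<close>. For \<open>n = 0\<close>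
  all these monomials would collapse to 1 and the coefficients of \<open>q\<close> would
  merge.\<close>

lemma inj_diag_monomial: "n \<ge> 1 \<Longrightarrow> inj (diag_monomial n)"
proof (rule injI)
  fix j k assume "n \<ge> 1" "diag_monomial n j = diag_monomial n k"
  then show "j = k"
    using lookup_diag_monomial[of n j 1] lookup_diag_monomial[of n k 1] by simp
qed

lemma lookup_diag_mpoly:
  assumes "n \<ge> 1"
  shows "Poly_Mapping.lookup (diag_mpoly n q) (diag_monomial n j) = coeff q j"
  using inj_diag_monomial[OF assms]
  by (auto simp: diag_mpoly_def lookup_sum lookup_single when_def inj_eq coeff_eq_0)

lemma keys_diag_mpoly_subset: "Poly_Mapping.keys (diag_mpoly n q) \<subseteq> diag_monomial n ` {..degree q}"
  unfolding diag_mpoly_def by (rule order.trans[OF keys_sum]) auto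

lemma keys_diag_mpoly:
  assumes "n \<ge> 1"
  shows "Poly_Mapping.keys (diag_mpoly n q) = diag_monomial n ` {j. coeff q j \<noteq> 0}"
  using keys_diag_mpoly_subset[of n q] lookup_diag_mpoly[OF assms, of q]
  by (auto simp: in_keys_iff)

lemma diag_mpoly_in_mpolys_in: "diag_mpoly n q \<in> mpolys_in n"
  using keys_diag_mpoly_subset[of n q]
  by (force simp: mpolys_in_def mpoly_vars_def keys_diag_monomial split: if_splits)

lemma mpoly_eval_diag_mpoly:
  assumes "n \<ge> 1"
  shows "mpoly_eval (diag_mpoly n q) x = poly q (\<Prod>i=1..n. x i)"
proof -
  \<comment> \<open>Vanishing coefficients of \<open>q\<close> add nothing, so the sum may run over
    all exponents up to the degree and be reindexed by them.\<close>
  have "mpoly_eval (diag_mpoly n q) x =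
      (\<Sum>m\<in>diag_monomial n ` {..degree q}. Poly_Mapping.lookup (diag_mpoly n q) m * monomial_eval x m)"
    unfolding mpoly_eval_def
    by (rule sum.mono_neutral_left) (use keys_diag_mpoly_subset in \<open>auto simp: in_keys_iff\<close>)
  also have "\<dots> = (\<Sum>j\<le>degree q. coeff q j * (\<Prod>i=1..n. x i) ^ j)"
    using inj_diag_monomial[OF assms]
    by (subst sum.reindex)
       (auto simp: inj_on_def lookup_diag_mpoly[OF assms] monomial_eval_diag_monomial)
  finally show ?thesis by (simp add: poly_altdef)
qed

lemma total_degree_diag_mpoly:
  assumes "n \<ge> 1"
  shows "total_degree (diag_mpoly n q) = n * degree q"
proof (cases "q = 0")
  \<comment> \<open>Here the support is empty, and both degrees are 0 by convention.\<close>
  case True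
  then show ?thesis using keys_diag_mpoly[OF assms, of q] by (simp add: total_degree_def)
next
  case False
  then have "diag_monomial n (degree q) \<in> Poly_Mapping.keys (diag_mpoly n q)"
    by (auto simp: keys_diag_mpoly[OF assms])
  then have "n * degree q \<in> monomial_degree ` Poly_Mapping.keys (diag_mpoly n q)"
    by (metis imageI monomial_degree_diag_monomial)
  moreover have "d \<le> n * degree q" if "d \<in> monomial_degree ` Poly_Mapping.keys (diag_mpoly n q)" for d
    using that keys_diag_mpoly_subset[of n q] by (auto simp: monomial_degree_diag_monomial)
  ultimately show ?thesis
    unfolding total_degree_def by (intro Max_eqI) auto
qed

lemma sparsity_diag_mpoly:
  assumes "n \<ge> 1"
  shows "sparsity (diag_mpoly n q) = card {j. coeff q j \<noteq> 0}"
  unfolding sparsity_def keys_diag_mpoly[OF assms]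
  by (rule card_image) (use inj_diag_monomial[OF assms] in \<open>auto simp: inj_on_def\<close>)

lemma degree_prod_linear_factors:
  fixes r :: "nat \<Rightarrow> real"
  shows "degree (\<Prod>i<n. [:- r i, 1:]) = n"
  by (subst degree_prod_eq_sum_degree) auto

text \<open>Multiplying by \<open>X - r\<close> turns the coefficients \<open>c_j\<close> into
  \<open>c_(j-1) - r * c_j\<close>. If the \<open>c_j\<close> alternate in sign and
  \<open>r > 0\<close>, both terms have the same sign, so nothing cancels. The exponent
  \<open>n + j\<close> has the parity of \<open>n - j\<close> without truncation.\<close>

lemma coeff_prod_positive_roots_alternating:
  fixes r :: "nat \<Rightarrow> real"
  assumes "\<And>i. r i > 0" and "j \<le> n"
  shows "0 < (- 1) ^ (n + j) * coeff (\<Prod>i<n. [:- r i, 1:]) j"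
  using assms(2)
proof (induction n arbitrary: j)
  case 0
  then show ?case by simp
next
  case (Suc n)
  define q where "q = (\<Prod>i<n. [:- r i, 1:])"
  have high: "coeff q (Suc n) = 0"
    by (simp add: q_def coeff_eq_0 degree_prod_linear_factors)
  have IH: "0 < (- 1) ^ (n + i) * coeff q i" if "i \<le> n" for i
    using Suc.IH[OF that] by (simp add: q_def)
  \<comment> \<open>Only a weak inequality, since \<open>coeff q j\<close> is 0 at
    \<open>j = Suc n\<close>; for \<open>j > 0\<close> strictness comes from the shifted coefficient
    at \<open>j - 1\<close>.\<close>
  have nonneg: "0 \<le> r n * ((- 1) ^ (n + j) * coeff q j)"
    using IH[of j] high Suc.prems assms(1)[of n] by (cases "j = Suc n") auto
  have step: "(\<Prod>i<Suc n. [:- r i, 1:]) = [:- r n, 1:] * q"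
    by (simp add: q_def mult.commute)
  show ?case
  proof (cases j)
    case 0
    then show ?thesis
      using mult_pos_pos[OF assms(1)[of n] IH[of 0]] unfolding step by (simp add: algebra_simps)
  next
    case (Suc i)
    then show ?thesis
      using IH[of i] nonneg Suc.prems unfolding step by (simp add: algebra_simps)
  qed
qed

lemma coeff_support_prod_positive_roots:
  fixes r :: "nat \<Rightarrow> real"
  assumes "\<And>i. r i > 0"
  shows "{j. coeff (\<Prod>i<n. [:- r i, 1:]) j \<noteq> 0} = {..n}"
proof -
  have "coeff (\<Prod>i<n. [:- r i, 1:]) j \<noteq> 0" if "j \<le> n" for j
    using coeff_prod_positive_roots_alternating[of r, OF assms that] by fastforce
  moreover have "j \<le> n" if "coeff (\<Prod>i<n. [:- r i, 1:]) j \<noteq> 0" for j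
    using le_degree[OF that] by (simp add: degree_prod_linear_factors)
  ultimately show ?thesis by auto
qed

text \<open>For \<open>k > n\<close> all factors are positive, matching the truncated \<open>n - k = 0\<close>.\<close>

lemma prod_separating_powers_of_2_sign:
  "0 < (- 1) ^ (n - k) * (\<Prod>i<n. 2 ^ k - 3 / 2 * 2 ^ i :: real)"
proof (induction n)
  case 0
  then show ?case by simp
next
  case (Suc n)
  show ?case
  proof (cases "k \<le> n")
    case True
    \<comment> \<open>The new factor is negative, matching the increase of \<open>n - k\<close> by
      one.\<close>
    have "(2::real) ^ k \<le> 2 ^ n" using True by (simp add: power_increasing)
    then have "2 ^ k - 3 / 2 * 2 ^ n < (0::real)"
      using zero_less_power[of "2::real" n] by linarith
    from mult_pos_neg[OF Suc this] show ?thesis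
      using True by (simp add: Suc_diff_le mult.assoc)
  next
    case False
    \<comment> \<open>The new factor is positive, and the exponent stays at 0.\<close>
    have "(2::real) ^ Suc n \<le> 2 ^ k" using False by (intro power_increasing) auto
    then have "2 ^ k - 3 / 2 * 2 ^ n > (0::real)"
      using zero_less_power[of "2::real" n] unfolding power_Suc by linarith
    from mult_pos_pos[OF Suc this] show ?thesis
      using False by (simp add: mult.assoc)
  qed
qed

text \<open>Each coordinate equal to 2 adds one to the sum of an all-ones point and doubles its
  product, so the same count \<open>k\<close> governs both parity and product.\<close>

lemma cube_1_2_number_of_twos:
  assumes "a \<in> cube {1, 2} n"
  obtains k where "k \<le> n" "(\<Sum>i=1..n. a i) = int (n + k)" "(\<Prod>i=1..n. real_of_int (a i)) = 2 ^ k"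
proof
  let ?T = "{i \<in> {1..n}. a i = 2}"
  have val: "a i = 1 + (if a i = 2 then 1 else 0)"
    "real_of_int (a i) = (if a i = 2 then 2 else 1)" if "i \<in> {1..n}" for i
    using assms that by (auto simp: cube_def PiE_iff)
  show "card ?T \<le> n" using card_mono[of "{1..n}" ?T] by fastforce
  have "(\<Sum>i=1..n. a i) = (\<Sum>i=1..n. 1 + (if a i = 2 then 1 else 0))"
    by (rule sum.cong[OF refl]) (rule val(1))
  also have "\<dots> = int (n + card ?T)"
    by (simp add: sum.distrib sum.If_cases Int_def)
  finally show "(\<Sum>i=1..n. a i) = int (n + card ?T)" .
  have "(\<Prod>i=1..n. real_of_int (a i)) = (\<Prod>i=1..n. if a i = 2 then 2 else 1)"
    by (rule prod.cong[OF refl]) (rule val(2))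
  also have "\<dots> = 2 ^ card ?T" by (simp add: prod.If_cases Int_def)
  finally show "(\<Prod>i=1..n. real_of_int (a i)) = 2 ^ card ?T" .
qed

theorem theorem4p1:
  fixes n :: nat
  assumes "n \<ge> 1"
  shows "\<exists>P \<in> mpolys_in n.
           sign_represents P {1, 2} n (parity_fun n) \<and>
           total_degree P = n\<^sup>2 \<and>
           sparsity P = n + 1"
proof (intro bexI conjI)
  \<comment> \<open>The root \<open>3/2 * 2^i\<close> is the midpoint of \<open>2^i\<close> and
    \<open>2^(i+1)\<close>, so \<open>q\<close> changes sign exactly once between consecutive values
    of the product.\<close>
  define q :: "real poly" where "q = (\<Prod>i<n. [:- (3 / 2 * 2 ^ i), 1:])"
  show "diag_mpoly n q \<in> mpolys_in n" by (rule diag_mpoly_in_mpolys_in)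
  show "total_degree (diag_mpoly n q) = n\<^sup>2"
    by (simp only: total_degree_diag_mpoly[OF assms] q_def degree_prod_linear_factors power2_eq_square)
  show "sparsity (diag_mpoly n q) = n + 1"
    unfolding sparsity_diag_mpoly[OF assms] q_def
    by (subst coeff_support_prod_positive_roots) auto
  show "sign_represents (diag_mpoly n q) {1, 2} n (parity_fun n)"
    unfolding sign_represents_def
  proof
    fix a assume "a \<in> cube {1, 2} n"
    then obtain k where k: "k \<le> n" "(\<Sum>i=1..n. a i) = int (n + k)"
        "(\<Prod>i=1..n. real_of_int (a i)) = 2 ^ k"
      by (rule cube_1_2_number_of_twos)
    let ?v = "mpoly_eval (diag_mpoly n q) (\<lambda>i. real_of_int (a i))"
    have "?v = (\<Prod>i<n. 2 ^ k - 3 / 2 * 2 ^ i)"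
      unfolding mpoly_eval_diag_mpoly[OF assms] k(3) by (simp add: q_def poly_prod)
    then have sign: "0 < (- 1) ^ (n - k) * ?v"
      using prod_separating_powers_of_2_sign[of n k] by simp
    \<comment> \<open>\<open>n + k\<close> and \<open>n - k\<close> differ by \<open>2 * k\<close>;
      \<open>k \<le> n\<close> rules out truncation.\<close>
    have par: "parity_fun n a = (if even (n - k) then 0 else 1)"
      using k(1) unfolding parity_fun_def k(2) by (auto simp: zmod_int mod2_eq_if)
    show "(parity_fun n a = 0 \<longrightarrow> ?v > 0) \<and> (parity_fun n a = 1 \<longrightarrow> ?v < 0)"
      using sign par by (cases "even (n - k)") auto
  qed
qed

end
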